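(* For every non-negative integer $k$ and every real $x$ (and, more generally, for complex values of $x$), $${}_1\Psi_1\left(-\tfrac12,k;-\tfrac12,0;x\right)=(-1)^k\sqrt{\pi}\,\left(\tfrac12 x\right)^{k+1/2}\left\{I_{k-\frac12}(x)+I_{\frac12-k}(x)\right\}$$ and $${}_1\Psi_1\left(-\tfrac12,k;-\tfrac12,0;-x\right)=\frac{2}{\sqrt{\pi}}\left(\tfrac12 x\right)^{k+1/2}K_{k-\frac12}(x).$$
   Context: For a non-negative integer $k$, real $\rho\ne0$ and real or complex $z$, ${}_1\Psi_1(\rho,k;\rho,0;z)=\sum_{n=0}^\infty \frac{\Gamma(k+\rho n)}{\Gamma(\rho n)}\frac{z^n}{n!}$, where the quotient $\Gamma(k+\rho n)/\Gamma(\rho n)$ is understood (by a limit where necessary) as $\prod_{j=0}^{k-1}(\rho n+j)$ (equal to $1$ when $k=0$). $I_\nu$ and $K_\nu$ denote the modified Bessel functions of the first and second kinds. For $x$ not positive, the power $(\tfrac12x)^{k+1/2}$ and the Bessel functions are taken on the same branch, and at $x=0$ the right-hand sides are understood as limits. *)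

theory Defs
  imports "HOL-Analysis.Analysis"
begin

text \<open>The series ${}_1\Psi_1(\rho,k;\rho,0;z)$. The quotient $\Gamma(k+\rho n)/\Gamma(\rho n)$ is
  the product $\prod_{j<k}(\rho n+j)$, which also covers the poles of the Gamma function.\<close>

definition Psi11 :: "real \<Rightarrow> nat \<Rightarrow> complex \<Rightarrow> complex" where
  "Psi11 \<rho> k z = (\<Sum>n. (\<Prod>j<k. of_real \<rho> * of_nat n + of_nat j) * z ^ n / fact n)"

text \<open>A branch of the logarithm is any choice of logarithms of the nonzero complex numbers.
  No continuity is required, so every branch that is continuous on a slit plane, together with
  any choice of values on the slit, is covered; the principal branch is \<open>Ln\<close>.\<close>

definition log_branch :: "(complex \<Rightarrow> complex) \<Rightarrow> bool" where
  "log_branch L \<longleftrightarrow> (\<forall>z. z \<noteq> 0 \<longrightarrow> exp (L z) = z)"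

definition branch_powr :: "(complex \<Rightarrow> complex) \<Rightarrow> complex \<Rightarrow> complex \<Rightarrow> complex" where
  "branch_powr L z a = exp (a * L z)"

lemma log_branch_Ln: "log_branch Ln"
  by (simp add: log_branch_def)

lemma branch_powr_Ln: "z \<noteq> 0 \<Longrightarrow> branch_powr Ln z a = z powr a"
  by (simp add: branch_powr_def powr_def)

text \<open>The functions $I_\nu$ and $K_\nu$ on the branch \<open>L\<close>, for nonzero arguments. At integer order,
  $K_\nu$ is the limit of the quotient in the order.\<close>

definition bessel_I :: "(complex \<Rightarrow> complex) \<Rightarrow> complex \<Rightarrow> complex \<Rightarrow> complex" where
  "bessel_I L \<nu> z = branch_powr L (z / 2) \<nu> *
     (\<Sum>m. (z / 2) ^ (2 * m) * rGamma (of_nat m + \<nu> + 1) / fact m)"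

definition bessel_K :: "(complex \<Rightarrow> complex) \<Rightarrow> complex \<Rightarrow> complex \<Rightarrow> complex" where
  "bessel_K L \<nu> z =
     (let q = (\<lambda>\<mu>. of_real pi / 2 * (bessel_I L (- \<mu>) z - bessel_I L \<mu> z) / sin (\<mu> * of_real pi))
      in if \<nu> \<in> \<int> then Lim (at \<nu>) q else q \<nu>)"

end

theory Submission
  imports Defs
begin

text \<open>The even and the odd part of the series are, up to elementary factors, the power series of the
  two Bessel functions \<open>I\<^sub>\<nu>\<close> with \<open>\<nu> = k - 1/2\<close> and \<open>\<nu> = 1/2 - k\<close>: the duplication formula splits
  \<open>n!\<close>, and the product \<open>\<Prod>j<k. j - n/2\<close> vanishes for even \<open>n < 2k\<close> and otherwise shifts the
  argument of the reciprocal Gamma function by \<open>k\<close>. In the right-hand sides the powers combine to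
  the integral powers \<open>(x/2)\<^bsup>2k\<^esup>\<close> and \<open>x/2\<close>, so the branch is immaterial.\<close>

section \<open>Duplication and shift formulas for the reciprocal Gamma function\<close>

text \<open>Legendre duplication in reciprocal form. Passing from m to m + 1 multiplies (2m)! by 4
  (m + 1) (m + 1/2), and the recurrence of \<open>rGamma\<close> absorbs the factor m + 1/2.\<close>

lemma inverse_fact_even:
  "1 / fact (2 * m) = of_real (sqrt pi) * rGamma (of_nat m + 1 / 2 :: complex) / (4 ^ m * fact m)"
proof (induction m)
  case 0
  have "rGamma (1 / 2 :: complex) = inverse (of_real (sqrt pi))"
    by (simp add: rGamma_inverse_Gamma Gamma_one_half_complex)
  then show ?case by simp
next
  case (Suc m)
  have "of_nat m + 1 / 2 + 1 = (of_nat (Suc m) + 1 / 2 :: complex)"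
    by simp
  then have r: "rGamma (of_nat m + 1 / 2 :: complex) = (of_nat m + 1 / 2) * rGamma (of_nat (Suc m) + 1 / 2)"
    using rGamma_plus1[of "of_nat m + 1 / 2 :: complex"] by metis
  have nz: "of_nat m + 1 / 2 \<noteq> (0 :: complex)"
    by (auto simp: complex_eq_iff)
  have cancel: "a * (b * r) / c / (4 * d * b) = a * r / (4 * c * d)" if "b \<noteq> 0" for a b c d r :: complex
    using that by simp
  have "fact (2 * Suc m) = (4 * (of_nat m + 1) * (of_nat m + 1 / 2)) * (fact (2 * m) :: complex)"
    by (simp add: algebra_simps)
  then have "1 / (fact (2 * Suc m) :: complex)
      = (1 / fact (2 * m)) / (4 * (of_nat m + 1) * (of_nat m + 1 / 2))"
    by simp
  also have "\<dots> = of_real (sqrt pi) * rGamma (of_nat (Suc m) + 1 / 2) / (4 ^ Suc m * fact (Suc m))"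
    unfolding Suc.IH r cancel[OF nz] by (simp add: mult_ac add.commute)
  finally show ?case .
qed

text \<open>Dividing the even case by 2m + 1 = 2 (m + 1/2) raises the argument of
  \<open>rGamma\<close> from m + 1/2 to m + 3/2.\<close>

lemma inverse_fact_odd:
  "1 / fact (2 * m + 1) = of_real (sqrt pi) * rGamma (of_nat m + 3 / 2 :: complex) / (2 * 4 ^ m * fact m)"
proof -
  have r: "rGamma (of_nat m + 1 / 2 :: complex) = (of_nat m + 1 / 2) * rGamma (of_nat m + 3 / 2)"
    using rGamma_plus1[of "of_nat m + 1 / 2 :: complex"] by (simp add: add.assoc)
  have nz: "of_nat m + 1 / 2 \<noteq> (0 :: complex)"
    by (auto simp: complex_eq_iff)
  have cancel: "a * (b * r) / c / (2 * b) = a * r / (2 * c)" if "b \<noteq> 0" for a b c r :: complex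
    using that by simp
  have "fact (2 * m + 1) = (2 * (of_nat m + 1 / 2)) * (fact (2 * m) :: complex)"
    by (simp add: algebra_simps)
  then have "1 / (fact (2 * m + 1) :: complex) = (1 / fact (2 * m)) / (2 * (of_nat m + 1 / 2))"
    by simp
  also have "\<dots> = of_real (sqrt pi) * rGamma (of_nat m + 3 / 2) / (2 * 4 ^ m * fact m)"
    unfolding inverse_fact_even r by (simp only: cancel[OF nz] mult.assoc)
  finally show ?thesis .
qed

text \<open>Each factor j - z is minus the factor z - j with which the recurrence lowers the
  argument of \<open>rGamma\<close> by one. As \<open>rGamma\<close> is entire, no pole has to be
  excluded, and the identity serves integral z (even terms) and half-integral z (odd terms)
  alike.\<close>

lemma rGamma_falling_product:
  fixes z :: complex
  shows "(\<Prod>j<k. of_nat j - z) * rGamma (z + 1) = (- 1) ^ k * rGamma (z + 1 - of_nat k)"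
proof (induction k)
  case (Suc k)
  have r: "rGamma (z + 1 - of_nat (Suc k)) = (z - of_nat k) * rGamma (z + 1 - of_nat k)"
    using rGamma_plus1[of "z - of_nat k"] by (simp add: algebra_simps)
  have "(\<Prod>j<Suc k. of_nat j - z) * rGamma (z + 1)
      = ((\<Prod>j<k. of_nat j - z) * rGamma (z + 1)) * (of_nat k - z)"
    by simp
  then show ?case
    unfolding Suc r by (simp add: algebra_simps)
qed simp

section \<open>Absolute convergence and continuity of the series\<close>

text \<open>The product is a polynomial in n, hence at most a constant times exp (|\<rho>| n). This
  leaves the exponential series at exp |\<rho>| * |x| as majorant.\<close>

lemma summable_Psi11:
  fixes x :: complex
  shows "summable (\<lambda>n. norm ((\<Prod>j<k. of_real \<rho> * of_nat n + of_nat j) * x ^ n / fact n))"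
proof (rule summable_comparison_test')
  let ?B = "\<lambda>n. (fact k * exp (real k)) * ((exp \<bar>\<rho>\<bar> * norm x) ^ n /\<^sub>R fact n)"
  show "summable ?B"
    by (intro summable_mult summable_exp_generic)
  fix n
  let ?y = "\<bar>\<rho>\<bar> * real n + real k"
  have "norm (\<Prod>j<k. of_real \<rho> * of_nat n + of_nat j :: complex) \<le> (\<Prod>j<k. ?y)"
    unfolding prod_norm[symmetric]
  proof (rule prod_mono, safe)
    fix j assume "j < k"
    have "norm (of_real \<rho> * of_nat n + of_nat j :: complex) \<le> \<bar>\<rho>\<bar> * real n + real j"
      by (rule order.trans[OF norm_triangle_ineq]) (simp add: norm_mult)
    also have "\<dots> \<le> ?y" using \<open>j < k\<close> by simp
    finally show "norm (of_real \<rho> * of_nat n + of_nat j :: complex) \<le> ?y" .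
  qed simp
  also have "(\<Prod>j<k. ?y) = ?y ^ k" by simp
  \<comment> \<open>y^k / k! is a single term of the exponential series of y, whose terms are
    nonnegative.\<close>
  also have "?y ^ k \<le> fact k * exp ?y"
  proof -
    have "(\<Sum>i\<in>{k}. ?y ^ i /\<^sub>R fact i) \<le> exp ?y"
      unfolding exp_def by (rule sum_le_suminf) (auto simp: summable_exp)
    then show ?thesis by (simp add: field_simps)
  qed
  also have "exp ?y = exp (real k) * exp \<bar>\<rho>\<bar> ^ n"
    by (simp add: exp_add exp_of_nat_mult[symmetric] mult.commute)
  finally have "norm (\<Prod>j<k. of_real \<rho> * of_nat n + of_nat j :: complex) * (norm x ^ n / fact n)
      \<le> (fact k * (exp (real k) * exp \<bar>\<rho>\<bar> ^ n)) * (norm x ^ n / fact n)"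
    by (rule mult_right_mono) simp
  then show "norm (norm ((\<Prod>j<k. of_real \<rho> * of_nat n + of_nat j) * x ^ n / fact n)) \<le> ?B n"
    by (simp add: norm_mult norm_divide norm_power power_mult_distrib field_simps)
qed

lemma isCont_Psi11: "isCont (Psi11 \<rho> k) x"
proof -
  define c :: "nat \<Rightarrow> complex"
    where "c = (\<lambda>n. (\<Prod>j<k. of_real \<rho> * of_nat n + of_nat j) / fact n)"
  have "summable (\<lambda>n. c n * y ^ n)" for y
    using summable_norm_cancel[OF summable_Psi11[of \<rho> k y]] by (simp add: c_def)
  then have "isCont (\<lambda>y. \<Sum>n. c n * y ^ n) x"
    by (rule isCont_powser_converges_everywhere)
  also have "(\<lambda>y. \<Sum>n. c n * y ^ n) = Psi11 \<rho> k"
    by (simp add: Psi11_def c_def fun_eq_iff)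
  finally show ?thesis .
qed

section \<open>Even and odd parts of the series at \<rho> = -1/2\<close>

text \<open>The index starts at n = 2k because the earlier even terms vanish. The product lowers 1 /
  (m + k)! to 1 / m! up to sign; the other factor of the duplication formula, \<open>rGamma\<close>
  at m + k + 1/2, already is the coefficient for order k - 1/2.\<close>

lemma Psi11_minus_half_even_term:
  "(\<Prod>j<k. of_real (- 1 / 2) * of_nat (2 * (m + k)) + of_nat j) * x ^ (2 * (m + k)) / fact (2 * (m + k))
   = (- 1) ^ k * of_real (sqrt pi) * (x / 2) ^ (2 * k) *
     ((x / 2) ^ (2 * m) * rGamma (of_nat m + (of_nat k - 1 / 2) + 1) / fact m :: complex)"
proof -
  let ?P = "\<Prod>j<k. of_nat j - of_nat (m + k) :: complex"
  have rG: "rGamma (of_nat n + 1) = (1 / fact n :: complex)" for n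
    by (simp add: rGamma_inverse_Gamma Gamma_fact add.commute inverse_eq_divide)
  have quarter: "x ^ (2 * n) / 4 ^ n = (x / 2) ^ (2 * n)" for n
    by (simp add: power_mult power_divide)
  have "of_nat (m + k) + 1 - of_nat k = (of_nat m + 1 :: complex)"
    by simp
  then have P: "?P / fact (m + k) = (- 1) ^ k / fact m"
    using rGamma_falling_product[of "of_nat (m + k)" k] by (simp only: rG times_divide_eq_right mult_1_right)
  have "(\<Prod>j<k. of_real (- 1 / 2) * of_nat (2 * (m + k)) + of_nat j) * x ^ (2 * (m + k)) / fact (2 * (m + k))
      = ?P * x ^ (2 * (m + k)) * (1 / fact (2 * (m + k)))"
    by (simp add: algebra_simps)
  also have "\<dots> = (?P / fact (m + k)) * (x ^ (2 * (m + k)) / 4 ^ (m + k)) *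
      (of_real (sqrt pi) * rGamma (of_nat (m + k) + 1 / 2))"
    unfolding inverse_fact_even by simp
  also have "x ^ (2 * (m + k)) / 4 ^ (m + k) = (x / 2) ^ (2 * k) * (x / 2) ^ (2 * m)"
    unfolding quarter power_add[symmetric] by (simp only: distrib_left add.commute)
  also have "of_nat (m + k) + 1 / 2 = of_nat m + (of_nat k - 1 / 2) + (1 :: complex)"
    by simp
  finally show ?thesis
    unfolding P by simp
qed

text \<open>The roles are swapped: 1 / m! stays, and the product lowers the argument m + 3/2 of
  \<open>rGamma\<close> by k.\<close>

lemma Psi11_minus_half_odd_term:
  "(\<Prod>j<k. of_real (- 1 / 2) * of_nat (2 * m + 1) + of_nat j) * x ^ (2 * m + 1) / fact (2 * m + 1)
   = (- 1) ^ k * of_real (sqrt pi) * (x / 2) *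
     ((x / 2) ^ (2 * m) * rGamma (of_nat m + (1 / 2 - of_nat k) + 1) / fact m :: complex)"
proof -
  let ?P = "\<Prod>j<k. of_nat j - (of_nat m + 1 / 2) :: complex"
  have P: "?P * rGamma (of_nat m + 3 / 2) = (- 1) ^ k * rGamma (of_nat m + (1 / 2 - of_nat k) + 1)"
    using rGamma_falling_product[of "of_nat m + 1 / 2" k] by (simp add: algebra_simps)
  have "(\<Prod>j<k. of_real (- 1 / 2) * of_nat (2 * m + 1) + of_nat j) = ?P"
    by (rule prod.cong) (simp_all add: field_simps)
  then have "(\<Prod>j<k. of_real (- 1 / 2) * of_nat (2 * m + 1) + of_nat j) * x ^ (2 * m + 1) / fact (2 * m + 1)
      = ?P * x ^ (2 * m + 1) * (1 / fact (2 * m + 1))"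
    by simp
  also have "\<dots> = (?P * rGamma (of_nat m + 3 / 2)) * (x ^ (2 * m + 1) / (2 * 4 ^ m)) *
      (of_real (sqrt pi) / fact m)"
    unfolding inverse_fact_odd by simp
  also have "x ^ (2 * m + 1) / (2 * 4 ^ m) = (x / 2) * (x / 2) ^ (2 * m)"
    by (simp add: power_mult power_divide)
  finally show ?thesis
    unfolding P by simp
qed

lemma suminf_even_odd:
  fixes f :: "nat \<Rightarrow> 'a::banach"
  assumes "summable (\<lambda>n. norm (f n))"
  shows "summable (\<lambda>m. f (2 * m))" "summable (\<lambda>m. f (2 * m + 1))"
    and "suminf f = (\<Sum>m. f (2 * m)) + (\<Sum>m. f (2 * m + 1))"
proof -
  have sub: "summable (\<lambda>m. f (g m))" if "inj g" for g :: "nat \<Rightarrow> nat"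
    by (rule summable_norm_cancel) (use summable_reindex[OF assms that] in \<open>simp add: o_def\<close>)
  show e: "summable (\<lambda>m. f (2 * m))" and o: "summable (\<lambda>m. f (2 * m + 1))"
    by (simp_all add: sub inj_def)
  have "(\<lambda>m. sum f {m * 2..<m * 2 + 2}) sums suminf f"
    by (intro sums_group summable_sums summable_norm_cancel[OF assms]) simp
  moreover have "sum f {m * 2..<m * 2 + 2} = f (2 * m) + f (2 * m + 1)" for m
    by (simp add: numeral_2_eq_2 mult.commute)
  ultimately show "suminf f = (\<Sum>m. f (2 * m)) + (\<Sum>m. f (2 * m + 1))"
    using suminf_add[OF e o] by (simp add: sums_iff)
qed

text \<open>This form is free of any branch and valid at x = 0 too. Replacing x by -x only changes
  the sign of the second summand, which yields the second identity.\<close>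

lemma Psi11_minus_half:
  "Psi11 (- 1 / 2) k x = (- 1) ^ k * of_real (sqrt pi) *
     ((x / 2) ^ (2 * k) * (\<Sum>m. (x / 2) ^ (2 * m) * rGamma (of_nat m + (of_nat k - 1 / 2) + 1) / fact m) +
      (x / 2) * (\<Sum>m. (x / 2) ^ (2 * m) * rGamma (of_nat m + (1 / 2 - of_nat k) + 1) / fact m))"
proof -
  define f :: "nat \<Rightarrow> complex"
    where "f = (\<lambda>n. (\<Prod>j<k. of_real (- 1 / 2) * of_nat n + of_nat j) * x ^ n / fact n)"
  define s :: complex where "s = (- 1) ^ k * of_real (sqrt pi)"
  define A :: "nat \<Rightarrow> complex"
    where "A = (\<lambda>m. (x / 2) ^ (2 * m) * rGamma (of_nat m + (of_nat k - 1 / 2) + 1) / fact m)"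
  define B :: "nat \<Rightarrow> complex"
    where "B = (\<lambda>m. (x / 2) ^ (2 * m) * rGamma (of_nat m + (1 / 2 - of_nat k) + 1) / fact m)"
  have sf: "summable (\<lambda>n. norm (f n))"
    unfolding f_def by (rule summable_Psi11)
  note eo = suminf_even_odd[OF sf]
  have fA: "f (2 * (m + k)) = s * (x / 2) ^ (2 * k) * A m" for m
    unfolding f_def s_def A_def by (rule Psi11_minus_half_even_term)
  have fB: "f (2 * m + 1) = s * (x / 2) * B m" for m
    unfolding f_def s_def B_def by (rule Psi11_minus_half_odd_term)
  \<comment> \<open>The factor with j = m is -m + m.\<close>
  have f0: "f (2 * m) = 0" if "m < k" for m
  proof -
    have "\<exists>j\<in>{..<k}. of_real (- 1 / 2) * of_nat (2 * m) + of_nat j = (0 :: complex)"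
      using that by (intro bexI[of _ m]) auto
    then have "(\<Prod>j<k. of_real (- 1 / 2) * of_nat (2 * m) + of_nat j :: complex) = 0"
      by (intro prod_zero) auto
    then show ?thesis by (simp only: f_def) simp
  qed
  have "(\<Sum>m. f (2 * m)) = (\<Sum>m. f (2 * (m + k)))"
    using suminf_split_initial_segment[OF eo(1), of k] f0 by simp
  also have "\<dots> = s * (x / 2) ^ (2 * k) * suminf A"
  \<comment> \<open>Summability of \<open>A\<close> is inferred from that of the even terms by
    dividing out the constant factor. Where that factor is 0, both sides are 0.\<close>
  proof (cases "x = 0 \<and> k > 0")
    case False
    have "summable (\<lambda>m. f (2 * (m + k)))"
      using summable_ignore_initial_segment[OF eo(1), of k] by simp
    moreover have "s * (x / 2) ^ (2 * k) \<noteq> 0"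
      using False by (auto simp: s_def)
    ultimately have "summable A"
      unfolding fA by (simp only: summable_cmult_iff) auto
    then show ?thesis
      unfolding fA by (rule suminf_mult)
  next
    case True
    then show ?thesis unfolding fA by (simp add: power_0_left)
  qed
  finally have even: "(\<Sum>m. f (2 * m)) = s * (x / 2) ^ (2 * k) * suminf A" .
  have odd: "(\<Sum>m. f (2 * m + 1)) = s * (x / 2) * suminf B"
  proof (cases "x = 0")
    case False
    then have "s * (x / 2) \<noteq> 0"
      by (auto simp: s_def)
    with eo(2) have "summable B"
      unfolding fB by (simp only: summable_cmult_iff) auto
    then show ?thesis
      unfolding fB by (rule suminf_mult)
  qed (unfold fB, simp)
  have "Psi11 (- 1 / 2) k x = suminf f"
    by (simp only: Psi11_def f_def)
  then show ?thesis
    unfolding eo(3) even odd A_def B_def s_def by (simp only: algebra_simps)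
qed

section \<open>Branch powers, and K at half-odd order\<close>

text \<open>A change of \<open>L w\<close> by a multiple of 2 pi i does not affect exp (n *
  \<open>L w\<close>) for natural n.\<close>

lemma branch_powr_mult_of_nat:
  assumes "log_branch L" "w \<noteq> 0" "a + b = of_nat n"
  shows "branch_powr L w a * branch_powr L w b = w ^ n"
proof -
  have "branch_powr L w a * branch_powr L w b = exp (of_nat n * L w)"
    unfolding branch_powr_def assms(3)[symmetric] by (simp add: exp_add distrib_right)
  also have "\<dots> = w ^ n"
    using assms by (simp add: exp_of_nat_mult log_branch_def)
  finally show ?thesis .
qed

text \<open>The order is not an integer, so K is the quotient itself and no limit. Its denominator
  sin ((k - 1/2) pi) = -(-1)^k reverses the difference of the two I.\<close>

lemma bessel_K_half_odd:
  "bessel_K L (of_nat k - 1 / 2) x =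
     (- 1) ^ k * (of_real pi / 2) * (bessel_I L (of_nat k - 1 / 2) x - bessel_I L (1 / 2 - of_nat k) x)"
proof -
  have notint: "(of_nat k - 1 / 2 :: complex) \<notin> \<int>"
  proof
    assume "(of_nat k - 1 / 2 :: complex) \<in> \<int>"
    then obtain n where "of_nat k - 1 / 2 = (of_int n :: complex)"
      by (auto elim: Ints_cases)
    then have "(of_int (2 * int k - 1) :: complex) = of_int (2 * n)"
      by (simp add: field_simps)
    then have "2 * int k - 1 = 2 * n"
      by (simp only: of_int_eq_iff)
    then show False by presburger
  qed
  have "(of_nat k - 1 / 2) * of_real pi = (of_real (real k * pi - pi / 2) :: complex)"
    by (simp add: algebra_simps)
  then have "sin ((of_nat k - 1 / 2) * of_real pi) = (of_real (sin (real k * pi - pi / 2)) :: complex)"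
    by (simp only: sin_of_real)
  also have "sin (real k * pi - pi / 2) = - ((- 1) ^ k)"
    by (simp add: sin_diff cos_npi mult.commute)
  finally have sin: "sin ((of_nat k - 1 / 2) * of_real pi) = - ((- 1) ^ k :: complex)"
    by simp
  have "bessel_K L (of_nat k - 1 / 2) x =
      of_real pi / 2 * (bessel_I L (- (of_nat k - 1 / 2)) x - bessel_I L (of_nat k - 1 / 2) x) / - ((- 1) ^ k)"
    using notint by (simp add: bessel_K_def Let_def sin del: minus_diff_eq)
  then show ?thesis
    by (cases "even k") (simp_all add: algebra_simps)
qed

theorem mainTheorem3:
  fixes k :: nat and L :: "complex \<Rightarrow> complex"
  assumes "log_branch L"
  defines "R1 \<equiv> \<lambda>x. (- 1) ^ k * of_real (sqrt pi) * branch_powr L (x / 2) (of_nat k + 1 / 2) *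
             (bessel_I L (of_nat k - 1 / 2) x + bessel_I L (1 / 2 - of_nat k) x)"
      and "R2 \<equiv> \<lambda>x. of_real (2 / sqrt pi) * branch_powr L (x / 2) (of_nat k + 1 / 2) *
             bessel_K L (of_nat k - 1 / 2) x"
  shows "(\<forall>x. x \<noteq> 0 \<longrightarrow> Psi11 (- 1 / 2) k x = R1 x) \<and> (R1 \<longlongrightarrow> Psi11 (- 1 / 2) k 0) (at 0) \<and>
         (\<forall>x. x \<noteq> 0 \<longrightarrow> Psi11 (- 1 / 2) k (- x) = R2 x) \<and> (R2 \<longlongrightarrow> Psi11 (- 1 / 2) k (- 0)) (at 0)"
proof -
  let ?S = "\<lambda>\<nu> x. \<Sum>m. (x / 2) ^ (2 * m) * rGamma (of_nat m + \<nu> + 1) / fact m :: complex"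
  let ?p = "\<lambda>x. branch_powr L (x / 2) (of_nat k + 1 / 2)"
  \<comment> \<open>The exponents add up to (k + 1/2) + (k - 1/2) = 2k and (k + 1/2) + (1/2 - k) =
    1.\<close>
  have I1: "?p x * bessel_I L (of_nat k - 1 / 2) x = (x / 2) ^ (2 * k) * ?S (of_nat k - 1 / 2) x"
    and I2: "?p x * bessel_I L (1 / 2 - of_nat k) x = (x / 2) * ?S (1 / 2 - of_nat k) x"
    if "x \<noteq> 0" for x
    using branch_powr_mult_of_nat[OF assms(1), of "x / 2" "of_nat k + 1 / 2" "of_nat k - 1 / 2" "2 * k"]
      branch_powr_mult_of_nat[OF assms(1), of "x / 2" "of_nat k + 1 / 2" "1 / 2 - of_nat k" 1] that
    by (simp_all add: bessel_I_def mult.assoc[symmetric])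
  have eq1: "Psi11 (- 1 / 2) k x = R1 x" if "x \<noteq> 0" for x
    unfolding Psi11_minus_half R1_def mult.assoc distrib_left I1[OF that] I2[OF that] ..
  have eq2: "Psi11 (- 1 / 2) k (- x) = R2 x" if "x \<noteq> 0" for x
  proof -
    have "2 / sqrt pi * (pi / 2) = sqrt pi"
      by (simp add: real_div_sqrt)
    then have c: "of_real (2 / sqrt pi) * (of_real pi / 2) = (of_real (sqrt pi) :: complex)"
      by (metis of_real_divide of_real_mult of_real_numeral)
    have "R2 x = (- 1) ^ k * (of_real (2 / sqrt pi) * (of_real pi / 2)) *
        (?p x * bessel_I L (of_nat k - 1 / 2) x - ?p x * bessel_I L (1 / 2 - of_nat k) x)"
      unfolding R2_def bessel_K_half_odd by (simp only: algebra_simps)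
    also have "\<dots> = (- 1) ^ k * of_real (sqrt pi) *
        ((x / 2) ^ (2 * k) * ?S (of_nat k - 1 / 2) x - (x / 2) * ?S (1 / 2 - of_nat k) x)"
      unfolding c I1[OF that] I2[OF that] ..
    also have "\<dots> = Psi11 (- 1 / 2) k (- x)"
      unfolding Psi11_minus_half by simp
    finally show ?thesis ..
  qed
  \<comment> \<open>\<open>L\<close> is unconstrained at 0, so \<open>R1\<close> and
    \<open>R2\<close> are compared with the series on a punctured neighbourhood, and continuity of
    the series supplies the limits.\<close>
  have nz: "\<forall>\<^sub>F x :: complex in at 0. x \<noteq> 0"
    by (rule eventually_neq_at_within)
  have ev1: "\<forall>\<^sub>F x in at 0. Psi11 (- 1 / 2) k x = R1 x"
    using nz by eventually_elim (rule eq1)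
  have ev2: "\<forall>\<^sub>F x in at 0. Psi11 (- 1 / 2) k (- x) = R2 x"
    using nz by eventually_elim (rule eq2)
  have "(Psi11 (- 1 / 2) k \<longlongrightarrow> Psi11 (- 1 / 2) k 0) (at 0)"
    using isCont_Psi11 by (simp add: isCont_def)
  then have lim1: "(R1 \<longlongrightarrow> Psi11 (- 1 / 2) k 0) (at 0)"
    by (rule Lim_transform_eventually[OF _ ev1])
  have "isCont (\<lambda>x. Psi11 (- 1 / 2) k (- x)) 0"
    by (intro isCont_o2[OF _ isCont_Psi11] continuous_intros)
  then have "((\<lambda>x. Psi11 (- 1 / 2) k (- x)) \<longlongrightarrow> Psi11 (- 1 / 2) k (- 0)) (at 0)"
    by (simp only: isCont_def)
  then have lim2: "(R2 \<longlongrightarrow> Psi11 (- 1 / 2) k (- 0)) (at 0)"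
    by (rule Lim_transform_eventually[OF _ ev2])
  show ?thesis
    using eq1 eq2 lim1 lim2 by blast
qed

end
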